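(* Let $a,b,c,d\in\mathbb{Z}$ with $abc\neq 0$ and $a\leq b\leq c$, let $\mathcal{L}_3$ denote the inequality $ax+by+cz+d<0$, and set $\sigma=a+b+c+d$. If $\mathcal{L}_3$ has a solution in the positive integers, then \[R(\mathcal{L}_3,2)=R(\mathcal{L}_3,\mathbb{Z}/3\mathbb{Z})=\begin{cases} 1 & \text{if } \sigma<0,\\[4pt] \left\lfloor \frac{d}{-a-b-c}\right\rfloor+1 & \text{if } \sigma\geq 0 \text{ and } a\leq b\leq c<0,\\[4pt] \left\lfloor \frac{c\left(\left\lfloor \frac{c+d}{-a-b}\right\rfloor+1\right)+d}{-a-b}\right\rfloor+1 & \text{if } \sigma\geq 0 \text{ and } a\leq b<0<c,\\[4pt] \left\lfloor \frac{(b+c)\left(\left\lfloor \frac{b+c+d}{-a}\right\rfloor+1\right)+d}{-a}\right\rfloor+1 & \text{if } \sigma\geq 0 \text{ and } a<0<b\leq c. \end{cases}\]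
   Context: For integers $a\le b$, $[a,b]=\{x\in\mathbb{N}: a\le x\le b\}$ and $[a,b]^3$ is the set of triples with entries in $[a,b]$. An $r$-coloring of $[1,n]$ is a function $\chi:[1,n]\to\{0,1,\dots,r-1\}$. For an inequality (or equation) $\mathcal{L}$ in three variables $x,y,z$, a solution $(x_1,x_2,x_3)\in[1,n]^3$ is monochromatic if $\chi(x_1)=\chi(x_2)=\chi(x_3)$, and zero-sum (for $r=3$) if $\chi(x_1)+\chi(x_2)+\chi(x_3)\equiv 0 \pmod 3$. $R(\mathcal{L},2)$ is the smallest positive integer $N$ (if it exists) such that for every $n\ge N$ and every $2$-coloring of $[1,n]$ there is a monochromatic solution of $\mathcal{L}$ in $[1,n]^3$. $R(\mathcal{L},\mathbb{Z}/3\mathbb{Z})$ is the smallest positive integer $N$ (if it exists) such that for every $n\ge N$ and every map $\chi:[1,n]\to\{0,1,2\}$ there is a zero-sum solution of $\mathcal{L}$ in $[1,n]^3$. *)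

theory Defs
  imports Complex_Main "HOL-Library.FuncSet" "HOL-Library.Extended_Nat" "HOL-Number_Theory.Cong"
begin

definition colorings :: "nat \<Rightarrow> nat \<Rightarrow> (nat \<Rightarrow> nat) set" where
  "colorings r n = {1..n} \<rightarrow>\<^sub>E {0..<r}"

definition mono_unavoidable :: "(nat \<Rightarrow> nat \<Rightarrow> nat \<Rightarrow> bool) \<Rightarrow> nat \<Rightarrow> nat \<Rightarrow> bool" where
  "mono_unavoidable L r n \<longleftrightarrow>
     (\<forall>\<chi> \<in> colorings r n. \<exists>x\<in>{1..n}. \<exists>y\<in>{1..n}. \<exists>z\<in>{1..n}.
        L x y z \<and> \<chi> x = \<chi> y \<and> \<chi> y = \<chi> z)"

definition zero_sum_unavoidable :: "(nat \<Rightarrow> nat \<Rightarrow> nat \<Rightarrow> bool) \<Rightarrow> nat \<Rightarrow> bool" where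
  "zero_sum_unavoidable L n \<longleftrightarrow>
     (\<forall>\<chi> \<in> colorings 3 n. \<exists>x\<in>{1..n}. \<exists>y\<in>{1..n}. \<exists>z\<in>{1..n}.
        L x y z \<and> [\<chi> x + \<chi> y + \<chi> z = 0] (mod 3))"

text \<open>The numbers below are the smallest positive integers with the stated property; they take the
  value \<open>\<infinity>\<close> (infimum of the empty set) exactly when no such integer exists.\<close>

definition rado_number :: "(nat \<Rightarrow> nat \<Rightarrow> nat \<Rightarrow> bool) \<Rightarrow> nat \<Rightarrow> enat" where
  "rado_number L r = Inf (enat ` {N. 1 \<le> N \<and> (\<forall>n\<ge>N. mono_unavoidable L r n)})"

definition zero_sum_rado_number :: "(nat \<Rightarrow> nat \<Rightarrow> nat \<Rightarrow> bool) \<Rightarrow> enat" where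
  "zero_sum_rado_number L = Inf (enat ` {N. 1 \<le> N \<and> (\<forall>n\<ge>N. zero_sum_unavoidable L n)})"

definition ineq3 :: "int \<Rightarrow> int \<Rightarrow> int \<Rightarrow> int \<Rightarrow> nat \<Rightarrow> nat \<Rightarrow> nat \<Rightarrow> bool" where
  "ineq3 a b c d x y z \<longleftrightarrow> a * int x + b * int y + c * int z + d < 0"

end

theory Submission
  imports Defs
begin

text \<open>
  A 2-coloring, read as a 3-coloring with values in \<open>{0, 1}\<close>, has only monochromatic zero-sum
  solutions, so both numbers equal \<open>N\<close> once every 3-coloring of \<open>[1, n]\<close> with \<open>n \<ge> N\<close> has a
  zero-sum solution and some 2-coloring of \<open>[1, N - 1]\<close> has no monochromatic one. For the former,
  take points \<open>1 \<le> K \<le> N\<close> such that the inequality has a solution using only two of them, for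
  each choice of the two, and a solution using all three: either two of the points share a color,
  or the three colors are 0, 1, 2. If \<open>K\<close> is the smallest number making \<open>(K, K, 1)\<close>, respectively
  \<open>(K, 1, 1)\<close>, a solution, and \<open>N\<close> the smallest one making \<open>(N, N, K)\<close>, respectively
  \<open>(N, K, K)\<close>, a solution, then the 2-coloring with classes \<open>[1, K - 1]\<close> and \<open>[K, N - 1]\<close> has no
  monochromatic solution.
\<close>

section \<open>Reduction to an upper bound for zero-sums and a lower bound for two colors\<close>

lemma zero_sum_imp_mono_unavoidable:
  assumes "zero_sum_unavoidable L n"
  shows "mono_unavoidable L 2 n"
  unfolding mono_unavoidable_def
proof
  fix \<chi> assume \<chi>: "\<chi> \<in> colorings 2 n"
  then have "\<chi> \<in> colorings 3 n"
    by (auto simp: colorings_def PiE_iff)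
  then obtain x y z where xyz: "x \<in> {1..n}" "y \<in> {1..n}" "z \<in> {1..n}" "L x y z"
    and sum0: "[\<chi> x + \<chi> y + \<chi> z = 0] (mod 3)"
    using assms unfolding zero_sum_unavoidable_def by blast
  have "\<chi> x < 2" "\<chi> y < 2" "\<chi> z < 2"
    using \<chi> xyz by (auto simp: colorings_def PiE_iff)
  then have "\<chi> x \<in> {0, 1}" "\<chi> y \<in> {0, 1}" "\<chi> z \<in> {0, 1}" by auto
  \<comment> \<open>Three values from \<open>{0, 1}\<close> add up to at most 3, so a sum divisible
    by 3 is 0 or 3.\<close>
  then have "\<chi> x = \<chi> y \<and> \<chi> y = \<chi> z"
    using sum0 by (auto simp: cong_def dest: dvd_imp_le)
  then show "\<exists>x\<in>{1..n}. \<exists>y\<in>{1..n}. \<exists>z\<in>{1..n}. L x y z \<and> \<chi> x = \<chi> y \<and> \<chi> y = \<chi> z"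
    using xyz by blast
qed

text \<open>Zero-sum unavoidability passes to two colors, and failure for two colors passes back, so
  each hypothesis serves both numbers.\<close>

lemma rado_numbers_eqI:
  assumes "1 \<le> N"
    and unavoidable: "\<And>n. N \<le> n \<Longrightarrow> zero_sum_unavoidable L n"
    and avoidable: "\<not> mono_unavoidable L 2 (N - 1)"
  shows "rado_number L 2 = enat N \<and> zero_sum_rado_number L = enat N"
proof -
  \<comment> \<open>\<open>P\<close> need not be monotone: a candidate \<open>M\<close> below
    \<open>N\<close> would have to satisfy \<open>P\<close> at \<open>N - 1\<close> too.\<close>
  have least: "Inf (enat ` {M. 1 \<le> M \<and> (\<forall>n\<ge>M. P n)}) = enat N"
    if "\<And>n. N \<le> n \<Longrightarrow> P n" "\<not> P (N - 1)" for P :: "nat \<Rightarrow> bool"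
  proof (rule antisym)
    show "Inf (enat ` {M. 1 \<le> M \<and> (\<forall>n\<ge>M. P n)}) \<le> enat N"
      using \<open>1 \<le> N\<close> that(1) by (intro Inf_lower) auto
    have "N \<le> M" if M: "1 \<le> M" "\<forall>n\<ge>M. P n" for M
    proof (rule ccontr)
      assume "\<not> N \<le> M"
      then have "M \<le> N - 1" by simp
      then show False using M(2) \<open>\<not> P (N - 1)\<close> by blast
    qed
    then show "enat N \<le> Inf (enat ` {M. 1 \<le> M \<and> (\<forall>n\<ge>M. P n)})"
      by (intro Inf_greatest) auto
  qed
  show ?thesis
    unfolding rado_number_def zero_sum_rado_number_def
    using least[of "mono_unavoidable L 2"] least[of "zero_sum_unavoidable L"]
      unavoidable avoidable zero_sum_imp_mono_unavoidable by blast
qed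

text \<open>Pigeonhole on the colors of \<open>p\<close>, \<open>q\<close>, \<open>r\<close>. The
  points may coincide; with all three equal, a single diagonal solution suffices.\<close>

lemma zero_sum_unavoidable_three_points:
  assumes range: "p \<in> {1..n}" "q \<in> {1..n}" "r \<in> {1..n}"
    and pq: "\<exists>x\<in>{p, q}. \<exists>y\<in>{p, q}. \<exists>z\<in>{p, q}. L x y z"
    and pr: "\<exists>x\<in>{p, r}. \<exists>y\<in>{p, r}. \<exists>z\<in>{p, r}. L x y z"
    and qr: "\<exists>x\<in>{q, r}. \<exists>y\<in>{q, r}. \<exists>z\<in>{q, r}. L x y z"
    and pqr: "L p q r"
  shows "zero_sum_unavoidable L n"
  unfolding zero_sum_unavoidable_def
proof
  fix \<chi> assume \<chi>: "\<chi> \<in> colorings 3 n"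
  let ?goal = "\<exists>x\<in>{1..n}. \<exists>y\<in>{1..n}. \<exists>z\<in>{1..n}. L x y z \<and> [\<chi> x + \<chi> y + \<chi> z = 0] (mod 3)"
  have pair: ?goal
    if uv: "u \<in> {1..n}" "v \<in> {1..n}" "\<chi> u = \<chi> v"
      and ex: "\<exists>x\<in>{u, v}. \<exists>y\<in>{u, v}. \<exists>z\<in>{u, v}. L x y z" for u v
  proof -
    obtain x y z where xyz: "x \<in> {u, v}" "y \<in> {u, v}" "z \<in> {u, v}" "L x y z"
      using ex by blast
    then have "\<chi> x + \<chi> y + \<chi> z = 3 * \<chi> u"
      using uv by auto
    then have "[\<chi> x + \<chi> y + \<chi> z = 0] (mod 3)"
      by (simp add: cong_def)
    moreover have "x \<in> {1..n}" "y \<in> {1..n}" "z \<in> {1..n}"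
      using xyz uv by auto
    ultimately show ?goal using xyz(4) by blast
  qed
  consider "\<chi> p = \<chi> q" | "\<chi> p = \<chi> r" | "\<chi> q = \<chi> r"
    | "\<chi> p \<noteq> \<chi> q" "\<chi> p \<noteq> \<chi> r" "\<chi> q \<noteq> \<chi> r" by blast
  then show ?goal
  proof cases
    case 1
    then show ?goal using pair[of p q] range pq by simp
  next
    case 2
    then show ?goal using pair[of p r] range pr by simp
  next
    case 3
    then show ?goal using pair[of q r] range qr by simp
  next
    case 4
    have "\<chi> p < 3" "\<chi> q < 3" "\<chi> r < 3"
      using \<chi> range by (auto simp: colorings_def PiE_iff)
    then have "\<chi> p \<in> {0, 1, 2}" "\<chi> q \<in> {0, 1, 2}" "\<chi> r \<in> {0, 1, 2}" by auto
    then have "\<chi> p + \<chi> q + \<chi> r = 3" using 4 by auto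
    then have "[\<chi> p + \<chi> q + \<chi> r = 0] (mod 3)" by (simp add: cong_def)
    then show ?goal using range pqr by blast
  qed
qed

text \<open>Color by the side of \<open>k\<close>, so that each color class is an interval. For
  \<open>k = 1\<close> the lower class is empty and the coloring is constant.\<close>

lemma not_mono_unavoidable_threshold:
  assumes lower: "\<And>x y z. \<lbrakk>x \<in> {1..<k}; y \<in> {1..<k}; z \<in> {1..<k}\<rbrakk> \<Longrightarrow> \<not> L x y z"
    and upper: "\<And>x y z. \<lbrakk>x \<in> {k..n}; y \<in> {k..n}; z \<in> {k..n}\<rbrakk> \<Longrightarrow> \<not> L x y z"
  shows "\<not> mono_unavoidable L 2 n"
proof
  assume mono: "mono_unavoidable L 2 n"
  define \<chi> :: "nat \<Rightarrow> nat" where "\<chi> = (\<lambda>x\<in>{1..n}. if x < k then 0 else 1)"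
  have "\<chi> \<in> colorings 2 n" by (auto simp: \<chi>_def colorings_def)
  then obtain x y z where xyz: "x \<in> {1..n}" "y \<in> {1..n}" "z \<in> {1..n}" "L x y z"
      and "\<chi> x = \<chi> y" "\<chi> y = \<chi> z"
    using mono unfolding mono_unavoidable_def by blast
  moreover have "\<chi> w = 0 \<longleftrightarrow> w < k" if "w \<in> {1..n}" for w
    using that by (simp add: \<chi>_def)
  ultimately have "(x < k \<longleftrightarrow> y < k) \<and> (y < k \<longleftrightarrow> z < k)"
    by metis
  moreover have "w \<in> {1..<k}" if "w \<in> {1..n}" "w < k" for w
    using that by simp
  moreover have "w \<in> {k..n}" if "w \<in> {1..n}" "\<not> w < k" for w
    using that by simp
  ultimately show False
    using lower upper xyz by metis
qed

section \<open>Thresholds given by integer division\<close>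

text \<open>\<open>N\<close> is the least integer with \<open>t < s * N\<close>: the last bound will
  make a triple a solution, the one before it will rule out smaller triples. As \<open>N\<close> is
  positive, \<open>nat\<close> in the closed formulas loses nothing.\<close>

lemma nat_div_succ:
  fixes s t :: int
  assumes "0 < s" "s \<le> t"
  obtains N :: nat where "int N = t div s + 1" "2 \<le> N" "s * (int N - 1) \<le> t" "t < s * int N"
proof
  let ?N = "nat (t div s + 1)"
  have "1 \<le> t div s" using zdiv_mono1[OF assms(2,1)] assms(1) by simp
  then show N: "int ?N = t div s + 1" and "2 \<le> ?N" by linarith+
  show "s * (int ?N - 1) \<le> t" "t < s * int ?N"
    using mult_div_mod_eq[of s t] pos_mod_bound[OF assms(1), of t] pos_mod_sign[OF assms(1), of t]
    unfolding N distrib_left add_diff_cancel_right' mult_1_right by linarith+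
qed

section \<open>The four sign patterns\<close>

lemma rado_numbers_ineq3_sum_neg:
  assumes "a + b + c + d < 0"
  shows "rado_number (ineq3 a b c d) 2 = 1 \<and> zero_sum_rado_number (ineq3 a b c d) = 1"
  unfolding one_enat_def
proof (rule rado_numbers_eqI)
  show "zero_sum_unavoidable (ineq3 a b c d) n" if "1 \<le> n" for n
    using assms that by (intro zero_sum_unavoidable_three_points[of 1 _ 1 1]) (auto simp: ineq3_def)
  \<comment> \<open>The interval \<open>{1..0}\<close> is empty, so both classes are free of
    solutions vacuously.\<close>
  show "\<not> mono_unavoidable (ineq3 a b c d) 2 (1 - 1)"
    by (rule not_mono_unavoidable_threshold[where k = 1]) auto
qed simp

text \<open>The left side decreases in every variable, so on \<open>[1, m]\<close> it is least at
  \<open>(m, m, m)\<close>. One color is therefore enough for the lower bound, and \<open>N\<close>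
  is the least number with \<open>(N, N, N)\<close> a solution.\<close>

lemma rado_numbers_ineq3_all_neg:
  assumes neg: "a < 0" "b < 0" "c < 0" and \<sigma>: "0 \<le> a + b + c + d"
  defines "N \<equiv> nat (d div (- a - b - c) + 1)"
  shows "rado_number (ineq3 a b c d) 2 = enat N \<and> zero_sum_rado_number (ineq3 a b c d) = enat N"
proof (rule rado_numbers_eqI)
  have "0 < - a - b - c" "- a - b - c \<le> d" using neg \<sigma> by auto
  then obtain N' where "int N' = d div (- a - b - c) + 1" "2 \<le> N'"
    "(- a - b - c) * (int N' - 1) \<le> d" "d < (- a - b - c) * int N'"
    by (rule nat_div_succ)
  then have N: "2 \<le> N" "(- a - b - c) * (int N - 1) \<le> d" "d < (- a - b - c) * int N"
    unfolding N_def by (metis nat_int)+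
  show "1 \<le> N" using N(1) by simp
  show "zero_sum_unavoidable (ineq3 a b c d) n" if "N \<le> n" for n
    using N that
    by (intro zero_sum_unavoidable_three_points[of N _ N N]) (auto simp: ineq3_def algebra_simps)
  show "\<not> mono_unavoidable (ineq3 a b c d) 2 (N - 1)"
  proof (rule not_mono_unavoidable_threshold[where k = 1])
    fix x y z assume "x \<in> {1..N - 1}" "y \<in> {1..N - 1}" "z \<in> {1..N - 1}"
    then have "int x \<le> int N - 1" "int y \<le> int N - 1" "int z \<le> int N - 1"
      by auto
    then have "a * (int N - 1) \<le> a * int x" "b * (int N - 1) \<le> b * int y"
      "c * (int N - 1) \<le> c * int z"
      using neg by (simp_all add: mult_left_mono_neg)
    then show "\<not> ineq3 a b c d x y z"
      using N(2) by (simp add: ineq3_def algebra_simps)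
  qed auto
qed

lemma rado_numbers_ineq3_two_neg:
  assumes sgn: "a < 0" "b < 0" "0 < c" and \<sigma>: "0 \<le> a + b + c + d"
  defines "N \<equiv> nat ((c * ((c + d) div (- a - b) + 1) + d) div (- a - b) + 1)"
  shows "rado_number (ineq3 a b c d) 2 = enat N \<and> zero_sum_rado_number (ineq3 a b c d) = enat N"
proof (rule rado_numbers_eqI)
  define s where "s = - a - b"
  have s: "0 < s" "s \<le> c + d" using sgn \<sigma> by (auto simp: s_def)
  then obtain K where K: "int K = (c + d) div s + 1" "2 \<le> K"
    "s * (int K - 1) \<le> c + d" "c + d < s * int K"
    by (rule nat_div_succ)
  \<comment> \<open>Raising \<open>z\<close> from 1 to \<open>K\<close> can only raise the threshold
    for \<open>x = y\<close>; this gives \<open>K \<le> N\<close>, and it makes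
    \<open>(N, N, 1)\<close> a solution along with \<open>(N, N, K)\<close>.\<close>
  have cK: "c + d \<le> c * int K + d" using K(2) sgn by simp
  then have "s \<le> c * int K + d" using s by simp
  then obtain N' where N': "int N' = (c * int K + d) div s + 1" "2 \<le> N'"
    "s * (int N' - 1) \<le> c * int K + d" "c * int K + d < s * int N'"
    using s(1) nat_div_succ by blast
  moreover have "N = N'"
    using N'(1) K(1) unfolding N_def s_def by (metis nat_int)
  ultimately have N: "2 \<le> N" "s * (int N - 1) \<le> c * int K + d" "c * int K + d < s * int N"
    by auto
  have "int K \<le> int N"
    using zdiv_mono1[OF cK s(1)] N'(1) K(1) \<open>N = N'\<close> by simp
  \<comment> \<open>Replacing the first \<open>K\<close> in \<open>(K, K, 1)\<close> by
    \<open>N\<close> lowers the left side, whence \<open>(N, K, 1)\<close> is a solution.\<close>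
  then have "a * int N \<le> a * int K"
    using sgn by (simp add: mult_left_mono_neg)
  show "1 \<le> N" using N(1) by simp
  show "zero_sum_unavoidable (ineq3 a b c d) n" if "N \<le> n" for n
  proof (rule zero_sum_unavoidable_three_points[of N _ K 1])
    show "N \<in> {1..n}" "K \<in> {1..n}" "1 \<in> {1..n}"
      using that N(1) K(2) \<open>int K \<le> int N\<close> by auto
    have "ineq3 a b c d N N K" "ineq3 a b c d N N 1" "ineq3 a b c d K K 1"
      using K(4) N(3) cK by (simp_all add: ineq3_def s_def algebra_simps)
    then show "\<exists>x\<in>{N, K}. \<exists>y\<in>{N, K}. \<exists>z\<in>{N, K}. ineq3 a b c d x y z"
      "\<exists>x\<in>{N, 1}. \<exists>y\<in>{N, 1}. \<exists>z\<in>{N, 1}. ineq3 a b c d x y z"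
      "\<exists>x\<in>{K, 1}. \<exists>y\<in>{K, 1}. \<exists>z\<in>{K, 1}. ineq3 a b c d x y z"
      by blast+
    show "ineq3 a b c d N K 1"
      using K(4) \<open>a * int N \<le> a * int K\<close> by (simp add: ineq3_def s_def algebra_simps)
  qed
  show "\<not> mono_unavoidable (ineq3 a b c d) 2 (N - 1)"
  proof (rule not_mono_unavoidable_threshold[where k = K])
    \<comment> \<open>On this class the left side is least at \<open>(K - 1, K - 1, 1)\<close>, on
      the upper class at \<open>(N - 1, N - 1, K)\<close>; minimality of \<open>K\<close> and
      \<open>N\<close> makes both values nonnegative.\<close>
    fix x y z assume "x \<in> {1..<K}" "y \<in> {1..<K}" "z \<in> {1..<K}"
    then have "int x \<le> int K - 1" "int y \<le> int K - 1" "1 \<le> int z"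
      by auto
    then have "a * (int K - 1) \<le> a * int x" "b * (int K - 1) \<le> b * int y" "c * 1 \<le> c * int z"
      using sgn by (simp_all only: mult_left_mono_neg mult_left_mono less_imp_le)
    then show "\<not> ineq3 a b c d x y z"
      using K(3) by (simp add: ineq3_def s_def algebra_simps)
  next
    fix x y z assume "x \<in> {K..N - 1}" "y \<in> {K..N - 1}" "z \<in> {K..N - 1}"
    then have "int x \<le> int N - 1" "int y \<le> int N - 1" "int K \<le> int z"
      using N(1) by auto
    then have "a * (int N - 1) \<le> a * int x" "b * (int N - 1) \<le> b * int y"
      "c * int K \<le> c * int z"
      using sgn by (simp_all only: mult_left_mono_neg mult_left_mono less_imp_le)
    then show "\<not> ineq3 a b c d x y z"
      using N(2) by (simp add: ineq3_def s_def algebra_simps)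
  qed
qed

lemma rado_numbers_ineq3_one_neg:
  assumes sgn: "a < 0" "0 < b" "0 < c" and \<sigma>: "0 \<le> a + b + c + d"
  defines "N \<equiv> nat (((b + c) * ((b + c + d) div (- a) + 1) + d) div (- a) + 1)"
  shows "rado_number (ineq3 a b c d) 2 = enat N \<and> zero_sum_rado_number (ineq3 a b c d) = enat N"
proof (rule rado_numbers_eqI)
  define s where "s = - a"
  have s: "0 < s" "s \<le> b + c + d" using sgn \<sigma> by (auto simp: s_def)
  then obtain K where K: "int K = (b + c + d) div s + 1" "2 \<le> K"
    "s * (int K - 1) \<le> b + c + d" "b + c + d < s * int K"
    by (rule nat_div_succ)
  have bK: "b \<le> b * int K" and cK: "c \<le> c * int K" using K(2) sgn by simp_all
  then have bcK: "b + c + d \<le> (b + c) * int K + d" by (simp add: distrib_right)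
  then have "s \<le> (b + c) * int K + d" using s by simp
  then obtain N' where N': "int N' = ((b + c) * int K + d) div s + 1" "2 \<le> N'"
    "s * (int N' - 1) \<le> (b + c) * int K + d" "(b + c) * int K + d < s * int N'"
    using s(1) nat_div_succ by blast
  moreover have "N = N'"
    using N'(1) K(1) unfolding N_def s_def by (metis nat_int)
  ultimately have N: "2 \<le> N" "s * (int N - 1) \<le> (b + c) * int K + d"
    "(b + c) * int K + d < s * int N"
    by auto
  have "int K \<le> int N"
    using zdiv_mono1[OF bcK s(1)] N'(1) K(1) \<open>N = N'\<close> by simp
  show "1 \<le> N" using N(1) by simp
  show "zero_sum_unavoidable (ineq3 a b c d) n" if "N \<le> n" for n
  proof (rule zero_sum_unavoidable_three_points[of N _ K 1])
    show "N \<in> {1..n}" "K \<in> {1..n}" "1 \<in> {1..n}"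
      using that N(1) K(2) \<open>int K \<le> int N\<close> by auto
    have "ineq3 a b c d N K K" "ineq3 a b c d N 1 1" "ineq3 a b c d K 1 1"
      using K(4) N(3) bK cK by (simp_all add: ineq3_def s_def algebra_simps)
    then show "\<exists>x\<in>{N, K}. \<exists>y\<in>{N, K}. \<exists>z\<in>{N, K}. ineq3 a b c d x y z"
      "\<exists>x\<in>{N, 1}. \<exists>y\<in>{N, 1}. \<exists>z\<in>{N, 1}. ineq3 a b c d x y z"
      "\<exists>x\<in>{K, 1}. \<exists>y\<in>{K, 1}. \<exists>z\<in>{K, 1}. ineq3 a b c d x y z"
      by blast+
    \<comment> \<open>Unlike in the case of two negative coefficients, this comes from
      \<open>(N, K, K)\<close> by lowering \<open>z\<close>.\<close>
    show "ineq3 a b c d N K 1"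
      using N(3) cK by (simp add: ineq3_def s_def algebra_simps)
  qed
  show "\<not> mono_unavoidable (ineq3 a b c d) 2 (N - 1)"
  proof (rule not_mono_unavoidable_threshold[where k = K])
    \<comment> \<open>The extreme triples of the two classes are now \<open>(K - 1, 1, 1)\<close>
      and \<open>(N - 1, K, K)\<close>.\<close>
    fix x y z assume "x \<in> {1..<K}" "y \<in> {1..<K}" "z \<in> {1..<K}"
    then have "int x \<le> int K - 1" "1 \<le> int y" "1 \<le> int z"
      by auto
    then have "a * (int K - 1) \<le> a * int x" "b * 1 \<le> b * int y" "c * 1 \<le> c * int z"
      using sgn by (simp_all only: mult_left_mono_neg mult_left_mono less_imp_le)
    then show "\<not> ineq3 a b c d x y z"
      using K(3) by (simp add: ineq3_def s_def algebra_simps)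
  next
    fix x y z assume "x \<in> {K..N - 1}" "y \<in> {K..N - 1}" "z \<in> {K..N - 1}"
    then have "int x \<le> int N - 1" "int K \<le> int y" "int K \<le> int z"
      using N(1) by auto
    then have "a * (int N - 1) \<le> a * int x" "b * int K \<le> b * int y" "c * int K \<le> c * int z"
      using sgn by (simp_all only: mult_left_mono_neg mult_left_mono less_imp_le)
    then show "\<not> ineq3 a b c d x y z"
      using N(2) by (simp add: ineq3_def s_def algebra_simps)
  qed
qed

theorem theorem1:
  fixes a b c d \<sigma> :: int
  assumes "a * b * c \<noteq> 0"
    and "a \<le> b" and "b \<le> c"
    and "\<sigma> = a + b + c + d"
    and "\<exists>x y z. 1 \<le> x \<and> 1 \<le> y \<and> 1 \<le> z \<and> ineq3 a b c d x y z"
  shows "rado_number (ineq3 a b c d) 2 = zero_sum_rado_number (ineq3 a b c d)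
    \<and> (\<sigma> < 0 \<longrightarrow> zero_sum_rado_number (ineq3 a b c d) = 1)
    \<and> (\<sigma> \<ge> 0 \<and> a \<le> b \<and> b \<le> c \<and> c < 0 \<longrightarrow>
         zero_sum_rado_number (ineq3 a b c d) =
           enat (nat (\<lfloor>real_of_int d / real_of_int (- a - b - c)\<rfloor> + 1)))
    \<and> (\<sigma> \<ge> 0 \<and> a \<le> b \<and> b < 0 \<and> 0 < c \<longrightarrow>
         zero_sum_rado_number (ineq3 a b c d) =
           enat (nat (\<lfloor>real_of_int
             (c * (\<lfloor>real_of_int (c + d) / real_of_int (- a - b)\<rfloor> + 1) + d)
               / real_of_int (- a - b)\<rfloor> + 1)))
    \<and> (\<sigma> \<ge> 0 \<and> a < 0 \<and> 0 < b \<and> b \<le> c \<longrightarrow>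
         zero_sum_rado_number (ineq3 a b c d) =
           enat (nat (\<lfloor>real_of_int
             ((b + c) * (\<lfloor>real_of_int (b + c + d) / real_of_int (- a)\<rfloor> + 1) + d)
               / real_of_int (- a)\<rfloor> + 1)))"
proof -
  have nz: "a \<noteq> 0" "b \<noteq> 0" "c \<noteq> 0" using assms(1) by auto
  \<comment> \<open>Solvability enters here: were all coefficients nonnegative, the left side would
    be at least \<open>\<sigma>\<close> at every positive triple.\<close>
  have "a < 0" if "0 \<le> \<sigma>"
  proof (rule ccontr)
    assume "\<not> a < 0"
    then have pos: "0 \<le> a" "0 \<le> b" "0 \<le> c" using assms(2,3) by auto
    obtain x y z where "1 \<le> x" "1 \<le> y" "1 \<le> z" and sol: "ineq3 a b c d x y z"
      using assms(5) by blast
    then have "a * 1 \<le> a * int x" "b * 1 \<le> b * int y" "c * 1 \<le> c * int z"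
      using pos by (intro mult_left_mono; simp)+
    then show False
      using sol that assms(4) by (simp add: ineq3_def)
  qed
  then consider "\<sigma> < 0" | "0 \<le> \<sigma>" "a < 0" "b < 0" "c < 0"
    | "0 \<le> \<sigma>" "a < 0" "b < 0" "0 < c" | "0 \<le> \<sigma>" "a < 0" "0 < b" "0 < c"
    using nz assms(3) by linarith
  then show ?thesis
  proof cases
    case 1
    then show ?thesis
      using rado_numbers_ineq3_sum_neg[of a b c d] assms(4) by simp
  next
    case 2
    \<comment> \<open>From here on the floor of a real quotient of integers is rewritten as
      \<open>div\<close>, and the clauses for other sign patterns hold because their premises
      contradict the case.\<close>
    then show ?thesis
      using rado_numbers_ineq3_all_neg[of a b c d] assms(4)
      unfolding floor_divide_of_int_eq by simp
  next
    case 3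
    then show ?thesis
      using rado_numbers_ineq3_two_neg[of a b c d] assms(4)
      unfolding floor_divide_of_int_eq by (metis order.asym not_le)
  next
    case 4
    then show ?thesis
      using rado_numbers_ineq3_one_neg[of a b c d] assms(4)
      unfolding floor_divide_of_int_eq by (metis order.asym not_le)
  qed
qed

end
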